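(* Let $A$ be any commutative $\mathbb Q$-algebra, let $a(t)\in A[t]$ and $c\in A$, and let $D:=c\,\partial_t-a(t)$, viewed as a map $A[t]\to A[t]$. Assume $1\in\mathrm{Im}\,D$. Then $\mathrm{Im}\,D=A[t]$.
   Context: $\partial_t$ is the formal derivative with respect to $t$ on $A[t]$, so $D(f)=c\,\partial_t f-a(t)f$, and $\mathrm{Im}\,D:=D(A[t])$. Algebras are unital. *)

theory Defs
  imports "HOL-Algebra.UnivPoly" "HOL-Algebra.Algebraic_Closure_Type"
begin

text \<open>
  Algebras are taken in the locale-based sense of HOL-Algebra, so that zero divisors, nilpotents
  and also the zero ring are allowed. (The type-class function \<open>pderiv\<close> is restricted to
  coefficient rings without zero divisors.)
\<close>

abbreviation rat_ring :: "rat ring"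
  where "rat_ring \<equiv> ring_of_type_algebra"

definition UP_deriv :: "('a, 'm) ring_scheme \<Rightarrow> (nat \<Rightarrow> 'a) \<Rightarrow> (nat \<Rightarrow> 'a)"
  where "UP_deriv R f = (\<lambda>n. [Suc n] \<cdot>\<^bsub>R\<^esub> up_ring.coeff (UP R) f (Suc n))"

definition diff_op :: "('a, 'm) ring_scheme \<Rightarrow> 'a \<Rightarrow> (nat \<Rightarrow> 'a) \<Rightarrow> (nat \<Rightarrow> 'a) \<Rightarrow> (nat \<Rightarrow> 'a)"
  where "diff_op R c a f =
    (c \<odot>\<^bsub>UP R\<^esub> UP_deriv R f) \<ominus>\<^bsub>UP R\<^esub> (a \<otimes>\<^bsub>UP R\<^esub> f)"

lemma (in cring) UP_deriv_closed:
  assumes "f \<in> carrier (UP R)"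
  shows "UP_deriv R f \<in> carrier (UP R)"
proof -
  have f: "f \<in> up R" using assms by (simp add: UP_def)
  then obtain N where N: "bound \<zero> N f" by auto
  have "UP_deriv R f = (\<lambda>n. [Suc n] \<cdot> f (Suc n))"
    using f by (simp add: UP_deriv_def UP_def)
  moreover have "(\<lambda>n. [Suc n] \<cdot> f (Suc n)) \<in> up R"
  proof (rule mem_upI)
    show "[Suc n] \<cdot> f (Suc n) \<in> carrier R" for n
      using mem_upD[OF f, of "Suc n"] by (rule add.nat_pow_closed)
    have "bound \<zero> N (\<lambda>n. [Suc n] \<cdot> f (Suc n))"
      using N by (intro bound.intro) (simp add: bound.bound del: add.nat_pow_Suc)
    then show "\<exists>N. bound \<zero> N (\<lambda>n. [Suc n] \<cdot> f (Suc n))" ..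
  qed
  ultimately show ?thesis by (simp add: UP_def)
qed

lemma (in cring) diff_op_closed:
  assumes "c \<in> carrier R" "a \<in> carrier (UP R)" "f \<in> carrier (UP R)"
  shows "diff_op R c a f \<in> carrier (UP R)"
proof -
  note deriv = UP_deriv_closed[OF assms(3)]
  interpret UP_cring R "UP R" by unfold_locales
  show ?thesis
    using assms deriv by (simp add: diff_op_def P.minus_closed UP_smult_closed)
qed

end

theory Submission
  imports Defs
begin

text \<open>
  Fix \<open>f\<close> with \<open>D f = 1\<close> and write \<open>a\<^sub>i\<close>, \<open>f\<^sub>i\<close> for the coefficients of \<open>a\<close>, \<open>f\<close>. The map \<open>D\<close> is not
  linear over \<open>A[t]\<close>, but it is linear over \<open>A\<close>, so \<open>Im D\<close> is an \<open>A\<close>-submodule of \<open>A[t]\<close> and the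
  claim is that the quotient \<open>M = A[t] / Im D\<close> vanishes.

  Over a field the degrees in \<open>D f = 1\<close> leave only constant \<open>a\<close>, and of \<open>c\<close> and \<open>a\<^sub>0\<close> one is nonzero.
  Over \<open>A\<close> the trace of this is that \<open>a\<^sub>i\<close> for \<open>i > 0\<close> and \<open>a\<^sub>0 (1 + a\<^sub>0 f\<^sub>0)\<close> are nilpotent: comparing
  coefficients in \<open>c f' - a f = 1\<close> from the top downwards shows, once the
  coefficients above \<open>a\<^sub>i\<close> are known to be nilpotent, that a large power of \<open>a\<^sub>i\<close> annihilates \<open>f\<^sub>j\<close> up
  to nilpotents, for every \<open>j\<close> if \<open>i > 0\<close> and for \<open>j > 0\<close> if \<open>i = 0\<close>
  (\<open>top_coeff_absorbs\<close>, whence \<open>higher_coeff_nilpotent\<close> and \<open>const_coeff_nilpotent\<close>). The constant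
  coefficient gives in addition \<open>1 = c f\<^sub>1 - a\<^sub>0 f\<^sub>0\<close>.

  For finitely many nilpotent scalars \<open>x\<close>, a module \<open>M\<close> that is the sum of the \<open>x M\<close> is zero, whether
  or not it is finitely generated (\<open>nilpotent_Nakayama\<close>). So the nilpotent scalars above may be
  assumed to act as zero on \<open>M\<close>. Then \<open>D\<close> becomes \<open>c \<partial> - a\<^sub>0\<close>, that is, \<open>a\<^sub>0 g = c g'\<close> in \<open>M\<close>. Iterating,
  \<open>a\<^sub>0\<^sup>k g = c\<^sup>k g\<^sup>(\<^sup>k\<^sup>)\<close> is zero for \<open>k > deg g\<close>, and as \<open>a\<^sub>0 = - a\<^sub>0\<^sup>2 f\<^sub>0\<close> on \<open>M\<close>, already \<open>a\<^sub>0 g = 0\<close>. If \<open>h\<close> is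
  an antiderivative of \<open>g\<close>, which is where the rational scalars enter, then \<open>c g = c h' = a\<^sub>0 h = 0\<close>.
  Since \<open>c\<close> and \<open>a\<^sub>0\<close> generate the unit ideal, \<open>M = 0\<close> (\<open>submodule_eq_carrier_modulo_nilpotents\<close>).
\<close>

section \<open>The nilradical of a commutative ring\<close>

definition (in cring) nilradical :: "'a set"
  where "nilradical = {x \<in> carrier R. \<exists>n::nat. x [^] n = \<zero>}"

context cring begin

text \<open>
  This is the vanishing of \<open>(x + y)\<^sup>p\<^sup>+\<^sup>q\<close> without the binomial theorem: each factor \<open>x + y\<close> is split
  into \<open>x\<close> and \<open>y\<close> and merged with the monomial, so that the total exponent stays the same.
\<close>

lemma pow_sum_kills:
  assumes x: "x \<in> carrier R" "x [^] (p::nat) = \<zero>" and y: "y \<in> carrier R" "y [^] (q::nat) = \<zero>"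
    and "p + q \<le> i + j + k"
  shows "(x \<oplus> y) [^] k \<otimes> (x [^] i \<otimes> y [^] j) = \<zero>"
  using assms(5)
proof (induction k arbitrary: i j)
  case 0
  have pz: "z [^] n = \<zero>" if "z \<in> carrier R" "z [^] r = \<zero>" "r \<le> n" for z and r n :: nat
    using that nat_pow_mult[of z r "n - r"] by simp
  have "p \<le> i \<or> q \<le> j" using 0 by linarith
  then show ?case using pz[OF x] pz[OF y] x y by auto
next
  case (Suc k)
  have "(x \<oplus> y) [^] Suc k \<otimes> (x [^] i \<otimes> y [^] j)
      = (x \<oplus> y) [^] k \<otimes> (x [^] Suc i \<otimes> y [^] j) \<oplus> (x \<oplus> y) [^] k \<otimes> (x [^] i \<otimes> y [^] Suc j)"
  proof -
    define u v w where "u = (x \<oplus> y) [^] k" "v = x [^] i" "w = y [^] j"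
    have "u \<in> carrier R" "v \<in> carrier R" "w \<in> carrier R" unfolding u_v_w_def using x y by auto
    then have "u \<otimes> (x \<oplus> y) \<otimes> (v \<otimes> w) = u \<otimes> (v \<otimes> x \<otimes> w) \<oplus> u \<otimes> (v \<otimes> (w \<otimes> y))"
      using x y by algebra
    then show ?thesis unfolding u_v_w_def by simp
  qed
  also have "\<dots> = \<zero>" using Suc.IH[of "Suc i" j] Suc.IH[of i "Suc j"] Suc.prems by simp
  finally show ?case .
qed

lemma nilradical_ideal: "ideal nilradical R"
proof (rule idealI)
  show "ring R" by unfold_locales
  have mult: "x \<otimes> r \<in> nilradical" if "x \<in> nilradical" "r \<in> carrier R" for x r
  proof -
    from that obtain n :: nat where "x \<in> carrier R" "x [^] n = \<zero>" by (auto simp: nilradical_def)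
    then have "(x \<otimes> r) [^] n = \<zero>" using that by (simp add: nat_pow_distrib)
    then show ?thesis using that \<open>x \<in> carrier R\<close> unfolding nilradical_def by blast
  qed
  then show "x \<otimes> r \<in> nilradical" if "x \<in> nilradical" "r \<in> carrier R" for x r
    using that by blast
  then show "r \<otimes> x \<in> nilradical" if "x \<in> nilradical" "r \<in> carrier R" for x r
    using mult[OF that] that by (simp add: m_comm nilradical_def)
  show "subgroup nilradical (add_monoid R)"
  proof (rule add.subgroupI)
    show "nilradical \<subseteq> carrier R" by (auto simp: nilradical_def)
    have "\<zero> [^] (1::nat) = \<zero>" by simp
    then show "nilradical \<noteq> {}" unfolding nilradical_def by blast
    show "\<ominus> x \<in> nilradical" if "x \<in> nilradical" for x
    proof -
      have "x \<in> carrier R" using that by (simp add: nilradical_def)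
      then have "\<ominus> x = x \<otimes> \<ominus> \<one>" by algebra
      then show ?thesis using mult[OF that] by simp
    qed
    show "x \<oplus> y \<in> nilradical" if xy: "x \<in> nilradical" "y \<in> nilradical" for x y
    proof -
      from xy obtain p q :: nat where "x \<in> carrier R" "x [^] p = \<zero>" "y \<in> carrier R" "y [^] q = \<zero>"
        by (auto simp: nilradical_def)
      from this pow_sum_kills[OF this, of 0 0 "p + q"] show ?thesis by (auto simp: nilradical_def)
    qed
  qed
qed

lemma nilradical_radical:
  assumes "x \<in> carrier R" "x [^] (n::nat) \<in> nilradical"
  shows "x \<in> nilradical"
  using assms by (auto simp: nilradical_def nat_pow_pow)

end

section \<open>Nakayama's lemma for nilpotent scalars\<close>

context module begin

text \<open>
  The hypothesis is used for \<open>K = S + x M\<close>. From \<open>M = S + x M\<close> follows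
  \<open>x\<^sup>e M \<subseteq> S + x\<^sup>e\<^sup>+\<^sup>1 M\<close>, so \<open>x\<^sup>e M \<subseteq> S\<close> descends from the exponent at which \<open>x\<^sup>e = 0\<close> to \<open>e = 0\<close>.
\<close>

lemma nilpotent_mult_spans:
  assumes S: "submodule S R M" and x: "x \<in> nilradical"
    and K: "\<And>K. submodule K R M \<Longrightarrow> S \<subseteq> K \<Longrightarrow> (\<And>m. m \<in> carrier M \<Longrightarrow> x \<odot>\<^bsub>M\<^esub> m \<in> K)
      \<Longrightarrow> K = carrier M"
  shows "S = carrier M"
proof -
  obtain n :: nat where xc: "x \<in> carrier R" and xn: "x [^] n = \<zero>" using x by (auto simp: nilradical_def)
  interpret S: submodule S R M by fact
  have Sc: "s \<in> S \<Longrightarrow> s \<in> carrier M" for s using S.subset by auto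
  have S0: "\<zero>\<^bsub>M\<^esub> \<in> S" using S.one_closed by simp
  have Sadd: "s \<in> S \<Longrightarrow> s' \<in> S \<Longrightarrow> s \<oplus>\<^bsub>M\<^esub> s' \<in> S" for s s' using S.m_closed by simp
  define K where "K = {s \<oplus>\<^bsub>M\<^esub> x \<odot>\<^bsub>M\<^esub> m | s m. s \<in> S \<and> m \<in> carrier M}"
  have KI: "s \<oplus>\<^bsub>M\<^esub> x \<odot>\<^bsub>M\<^esub> m \<in> K" if "s \<in> S" "m \<in> carrier M" for s m
    using that K_def by blast
  have "K = carrier M"
  proof (rule K)
    show "submodule K R M"
    proof (rule submoduleI)
      show "K \<subseteq> carrier M" using Sc xc by (auto simp: K_def)
      show "\<zero>\<^bsub>M\<^esub> \<in> K" using KI[OF S0 M.zero_closed] xc by simp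
      show "u \<oplus>\<^bsub>M\<^esub> v \<in> K" if uv: "u \<in> K" "v \<in> K" for u v
      proof -
        from uv obtain s m s' m' where u: "u = s \<oplus>\<^bsub>M\<^esub> x \<odot>\<^bsub>M\<^esub> m" "s \<in> S" "m \<in> carrier M"
          and v: "v = s' \<oplus>\<^bsub>M\<^esub> x \<odot>\<^bsub>M\<^esub> m'" "s' \<in> S" "m' \<in> carrier M"
          by (auto simp: K_def)
        have "u \<oplus>\<^bsub>M\<^esub> v = (s \<oplus>\<^bsub>M\<^esub> s') \<oplus>\<^bsub>M\<^esub> x \<odot>\<^bsub>M\<^esub> (m \<oplus>\<^bsub>M\<^esub> m')"
          using u v Sc xc by (simp add: smult_r_distr M.a_ac)
        then show ?thesis using KI Sadd u v by simp
      qed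
      show r: "r \<odot>\<^bsub>M\<^esub> u \<in> K" if r: "r \<in> carrier R" "u \<in> K" for r u
      proof -
        from r obtain s m where u: "u = s \<oplus>\<^bsub>M\<^esub> x \<odot>\<^bsub>M\<^esub> m" "s \<in> S" "m \<in> carrier M"
          by (auto simp: K_def)
        have "r \<odot>\<^bsub>M\<^esub> u = r \<odot>\<^bsub>M\<^esub> s \<oplus>\<^bsub>M\<^esub> x \<odot>\<^bsub>M\<^esub> (r \<odot>\<^bsub>M\<^esub> m)"
          using u Sc xc r by (simp add: smult_r_distr smult_assoc1[symmetric] R.m_comm)
        then show ?thesis using KI u r by simp
      qed
      show "\<ominus>\<^bsub>M\<^esub> u \<in> K" if "u \<in> K" for u
      proof -
        have "u \<in> carrier M" using that Sc xc by (auto simp: K_def)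
        then show ?thesis using r[of "\<ominus> \<one>" u] that by (simp add: smult_l_minus)
      qed
    qed
    show "S \<subseteq> K" using KI[OF _ M.zero_closed] xc Sc by fastforce
    show "x \<odot>\<^bsub>M\<^esub> m \<in> K" if "m \<in> carrier M" for m using KI[OF S0 that] that xc by simp
  qed
  have pow: "x [^] (n - d) \<odot>\<^bsub>M\<^esub> m \<in> S" if "m \<in> carrier M" for d m
    using that
  proof (induction d arbitrary: m)
    case 0
    then show ?case using xn S0 by simp
  next
    case (Suc d)
    show ?case
    proof (cases "d < n")
      case True
      from Suc.prems have "m \<in> K" using \<open>K = carrier M\<close> by simp
      then obtain s m' where m: "m = s \<oplus>\<^bsub>M\<^esub> x \<odot>\<^bsub>M\<^esub> m'" "s \<in> S" "m' \<in> carrier M"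
        by (auto simp: K_def)
      have "n - d = Suc (n - Suc d)" using True by simp
      then have "x [^] (n - Suc d) \<odot>\<^bsub>M\<^esub> m = x [^] (n - Suc d) \<odot>\<^bsub>M\<^esub> s \<oplus>\<^bsub>M\<^esub> x [^] (n - d) \<odot>\<^bsub>M\<^esub> m'"
        using m Sc xc by (simp add: smult_r_distr smult_assoc1)
      then show ?thesis using Sadd Suc.IH m xc by simp
    next
      case False
      then show ?thesis using Suc by simp
    qed
  qed
  show ?thesis using pow[of _ n] Sc by fastforce
qed

text \<open>
  The hypothesis says \<open>M = S + \<Sum> x M\<close>, the sum over \<open>x \<in> Y\<close>. Quantifying over the submodules that
  contain \<open>S\<close> and all \<open>x M\<close> avoids forming this sum: in the induction, \<open>S\<close> is enlarged by one \<open>x M\<close>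
  at a time.
\<close>

lemma nilpotent_Nakayama:
  assumes "finite Y" "Y \<subseteq> nilradical" "submodule S R M"
    and "\<And>K. submodule K R M \<Longrightarrow> S \<subseteq> K \<Longrightarrow> (\<And>x m. x \<in> Y \<Longrightarrow> m \<in> carrier M \<Longrightarrow> x \<odot>\<^bsub>M\<^esub> m \<in> K)
      \<Longrightarrow> K = carrier M"
  shows "S = carrier M"
  using assms
proof (induction Y arbitrary: S rule: finite_induct)
  case empty
  then show ?case by blast
next
  case (insert x Y)
  show ?case
  proof (rule nilpotent_mult_spans)
    show "submodule S R M" "x \<in> nilradical" using insert.prems by auto
    show "K = carrier M" if K: "submodule K R M" "S \<subseteq> K" "\<And>m. m \<in> carrier M \<Longrightarrow> x \<odot>\<^bsub>M\<^esub> m \<in> K" for K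
    proof (rule insert.IH)
      show "Y \<subseteq> nilradical" using insert.prems by auto
      show "submodule K R M" by fact
      show "L = carrier M"
        if "submodule L R M" "K \<subseteq> L" "\<And>x m. x \<in> Y \<Longrightarrow> m \<in> carrier M \<Longrightarrow> x \<odot>\<^bsub>M\<^esub> m \<in> L" for L
        by (rule insert.prems(3)) (use K that in auto)
    qed
  qed
qed

end

section \<open>The operator \<open>c \<partial> - a\<close> on polynomials\<close>

lemma (in abelian_group) finsum_in_subgroup:
  assumes "subgroup H (add_monoid G)" "\<And>i. i \<in> I \<Longrightarrow> h i \<in> H"
  shows "finsum G h I \<in> H"
proof -
  interpret H: subgroup H "add_monoid G" by fact
  have sub: "x \<in> H \<Longrightarrow> x \<in> carrier G" for x using H.subset by auto
  show ?thesis
    using assms(2)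
  proof (induction I rule: infinite_finite_induct)
    case (infinite I)
    then show ?case using H.one_closed by (simp add: add.finprod_infinite)
  next
    case empty
    then show ?case using H.one_closed by simp
  next
    case (insert i I)
    then have "finsum G h (insert i I) = h i \<oplus> finsum G h I"
      by (intro finsum_insert) (auto intro: sub)
    then show ?case using H.m_closed insert by simp
  qed
qed

abbreviation (in UP) cf :: "(nat \<Rightarrow> 'a) \<Rightarrow> nat \<Rightarrow> 'a"
  where "cf \<equiv> up_ring.coeff P"

context UP_cring begin

lemma cf_apply: "f \<in> carrier P \<Longrightarrow> cf f = f"
  unfolding P_def UP_def by simp

lemma deriv_closed: "f \<in> carrier P \<Longrightarrow> UP_deriv R f \<in> carrier P"
  unfolding P_def by (rule R.UP_deriv_closed)

lemma coeff_UP_deriv: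
  assumes "f \<in> carrier P"
  shows "cf (UP_deriv R f) n = [Suc n] \<cdot> cf f (Suc n)"
  unfolding cf_apply[OF deriv_closed[OF assms]] by (simp only: UP_deriv_def P_def)

lemma diff_op_eq: "diff_op R c a f = c \<odot>\<^bsub>P\<^esub> UP_deriv R f \<ominus>\<^bsub>P\<^esub> a \<otimes>\<^bsub>P\<^esub> f"
  by (simp add: diff_op_def P_def)

lemma deriv_add:
  assumes "f \<in> carrier P" "g \<in> carrier P"
  shows "UP_deriv R (f \<oplus>\<^bsub>P\<^esub> g) = UP_deriv R f \<oplus>\<^bsub>P\<^esub> UP_deriv R g"
  using assms
  by (intro up_eqI) (simp_all add: coeff_UP_deriv deriv_closed R.add.nat_pow_distrib del: R.add.nat_pow_Suc)

lemma deriv_smult: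
  assumes "r \<in> carrier R" "f \<in> carrier P"
  shows "UP_deriv R (r \<odot>\<^bsub>P\<^esub> f) = r \<odot>\<^bsub>P\<^esub> UP_deriv R f"
  using assms
  by (intro up_eqI) (simp_all add: coeff_UP_deriv deriv_closed R.add_pow_rdistr del: R.add.nat_pow_Suc)

lemma diff_op_image_submodule:
  assumes c: "c \<in> carrier R" and a: "a \<in> carrier P"
  shows "submodule (diff_op R c a ` carrier P) R P"
proof (rule submoduleI)
  let ?D = "diff_op R c a"
  have cl: "?D f \<in> carrier P" if "f \<in> carrier P" for f
    using that c a by (simp add: diff_op_eq deriv_closed)
  then show "?D ` carrier P \<subseteq> carrier P" by blast
  have smult: "r \<odot>\<^bsub>P\<^esub> ?D f = ?D (r \<odot>\<^bsub>P\<^esub> f)" if "r \<in> carrier R" "f \<in> carrier P" for r f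
  proof -
    have "a \<otimes>\<^bsub>P\<^esub> (r \<odot>\<^bsub>P\<^esub> f) = r \<odot>\<^bsub>P\<^esub> (a \<otimes>\<^bsub>P\<^esub> f)"
      using that a UP_smult_assoc2[of r f a] by (simp add: P.m_comm)
    then show ?thesis
      using that c a by (simp add: diff_op_eq deriv_smult deriv_closed P.minus_eq UP_smult_r_distr
          smult_r_minus UP_smult_assoc1[symmetric] R.m_comm)
  qed
  show sm: "r \<odot>\<^bsub>P\<^esub> u \<in> ?D ` carrier P" if "r \<in> carrier R" "u \<in> ?D ` carrier P" for r u
    using that smult by auto
  show "u \<oplus>\<^bsub>P\<^esub> v \<in> ?D ` carrier P" if uv: "u \<in> ?D ` carrier P" "v \<in> ?D ` carrier P" for u v
  proof -
    from uv obtain f g where f: "f \<in> carrier P" "u = ?D f" and g: "g \<in> carrier P" "v = ?D g" by blast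
    define f' g' where "f' = c \<odot>\<^bsub>P\<^esub> UP_deriv R f" "g' = c \<odot>\<^bsub>P\<^esub> UP_deriv R g"
    have "f' \<in> carrier P" "g' \<in> carrier P" unfolding f'_g'_def using f g c by (simp_all add: deriv_closed)
    then have "(f' \<ominus>\<^bsub>P\<^esub> a \<otimes>\<^bsub>P\<^esub> f) \<oplus>\<^bsub>P\<^esub> (g' \<ominus>\<^bsub>P\<^esub> a \<otimes>\<^bsub>P\<^esub> g) = (f' \<oplus>\<^bsub>P\<^esub> g') \<ominus>\<^bsub>P\<^esub> a \<otimes>\<^bsub>P\<^esub> (f \<oplus>\<^bsub>P\<^esub> g)"
      using a f(1) g(1) by algebra
    then have "u \<oplus>\<^bsub>P\<^esub> v = ?D (f \<oplus>\<^bsub>P\<^esub> g)"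
      unfolding f'_g'_def using f g c by (simp add: diff_op_eq deriv_add UP_smult_r_distr deriv_closed)
    then show ?thesis using f g by blast
  qed
  have "\<zero>\<^bsub>P\<^esub> = \<zero> \<odot>\<^bsub>P\<^esub> ?D \<zero>\<^bsub>P\<^esub>" using cl by simp
  then show "\<zero>\<^bsub>P\<^esub> \<in> ?D ` carrier P"
    using sm[of \<zero> "?D \<zero>\<^bsub>P\<^esub>"] by (metis R.zero_closed UP_zero_closed imageI)
  show "\<ominus>\<^bsub>P\<^esub> u \<in> ?D ` carrier P" if u: "u \<in> ?D ` carrier P" for u
  proof -
    have "u \<in> carrier P" using u cl by auto
    then have "\<ominus>\<^bsub>P\<^esub> u = (\<ominus> \<one>) \<odot>\<^bsub>P\<^esub> u" by (simp add: smult_l_minus)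
    then show ?thesis using sm[of "\<ominus> \<one>" u] u by simp
  qed
qed

text \<open>
  Integration divides the coefficient of \<open>t\<^sup>n\<close> by \<open>n + 1\<close>, so it needs the positive integers to be
  invertible in the coefficient ring.
\<close>

lemma antiderivative:
  assumes units: "\<And>n. [Suc n] \<cdot> \<one> \<in> Units R" and g: "g \<in> carrier P"
  obtains h where "h \<in> carrier P" "UP_deriv R h = g"
proof -
  define h where "h = (\<lambda>n. case n of 0 \<Rightarrow> \<zero> | Suc k \<Rightarrow> inv ([Suc k] \<cdot> \<one>) \<otimes> cf g k)"
  have gc: "cf g k \<in> carrier R" for k using g by simp
  have "h \<in> up R"
  proof (rule mem_upI)
    show "h n \<in> carrier R" for n
      using gc units by (auto simp: h_def split: nat.split simp del: R.add.nat_pow_Suc)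
    have "h n = \<zero>" if n: "Suc (deg R g) < n" for n
    proof -
      obtain k where k: "n = Suc k" "deg R g < k" using n by (cases n) auto
      then have "cf g k = \<zero>" using g by (intro deg_aboveD)
      then show ?thesis using k units by (simp add: h_def del: R.add.nat_pow_Suc)
    qed
    then show "\<exists>n. bound \<zero> n h" by (meson bound.intro)
  qed
  then have h: "h \<in> carrier P" unfolding P_def UP_def by simp
  then have ch: "cf h = h" by (rule cf_apply)
  have "UP_deriv R h = g"
  proof (rule up_eqI)
    show "cf (UP_deriv R h) n = cf g n" for n
    proof -
      define u where "u = [Suc n] \<cdot> \<one>"
      have u: "u \<in> Units R" using units u_def by blast
      have "h (Suc n) = inv u \<otimes> cf g n" by (simp add: h_def u_def del: R.add.nat_pow_Suc)
      moreover have "[Suc n] \<cdot> h (Suc n) = u \<otimes> h (Suc n)"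
        using coeff_closed[OF h, of "Suc n"] R.add_pow_ldistr[of \<one> "h (Suc n)" "Suc n"]
        unfolding ch u_def by (simp del: R.add.nat_pow_Suc)
      ultimately show ?thesis
        using u gc[of n] by (simp add: coeff_UP_deriv h ch R.m_assoc[symmetric] R.Units_closed del: R.add.nat_pow_Suc)
    qed
  qed (use h g deriv_closed in auto)
  then show thesis using that h by blast
qed

section \<open>Nilpotents forced by a preimage of one\<close>

lemma preimage_of_one_coeff:
  assumes c: "c \<in> carrier R" and a: "a \<in> carrier P" and f: "f \<in> carrier P"
    and D: "diff_op R c a f = \<one>\<^bsub>P\<^esub>"
  shows "c \<otimes> [Suc n] \<cdot> cf f (Suc n) \<ominus> (\<Oplus>k\<in>{..n}. cf a k \<otimes> cf f (n - k))
    = (if n = 0 then \<one> else \<zero>)"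
proof -
  have "cf (diff_op R c a f) n = (if n = 0 then \<one> else \<zero>)" using D by simp
  then show ?thesis using assms
    by (simp add: diff_op_eq P.minus_eq R.minus_eq deriv_closed coeff_UP_deriv del: R.add.nat_pow_Suc)
qed

text \<open>
  Modulo \<open>N\<close> the polynomial \<open>a\<close> ends at \<open>a\<^sub>i\<close>. The coefficient of \<open>t\<^sup>i\<^sup>+\<^sup>j\<close> in \<open>c f' - a f = 1\<close> then
  expresses \<open>a\<^sub>i f\<^sub>j\<close> through coefficients of \<open>f\<close> with index above \<open>j\<close>: the derivative contributes
  \<open>f\<close> at \<open>i + j + 1\<close>, and \<open>a\<^sub>k\<close> with \<open>k < i\<close> meets \<open>f\<close> at \<open>i + j - k\<close>. So each
  further factor \<open>a\<^sub>i\<close> lowers by one the index \<open>j\<close> that is reached, starting above the degree of \<open>f\<close>.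
  The condition \<open>i + j > 0\<close> excludes the constant coefficient, whose right-hand side is \<open>1\<close>.
\<close>

lemma top_coeff_absorbs:
  assumes c: "c \<in> carrier R" and a: "a \<in> carrier P" and f: "f \<in> carrier P"
    and D: "diff_op R c a f = \<one>\<^bsub>P\<^esub>"
    and N: "ideal N R" and top: "\<And>k. i < k \<Longrightarrow> cf a k \<in> N"
    and m: "\<And>j. m < j \<Longrightarrow> cf f j = \<zero>"
  shows "m < j + d \<Longrightarrow> 0 < i + j \<Longrightarrow> cf a i [^] d \<otimes> cf f j \<in> N"
proof (induction d arbitrary: j)
  interpret N: ideal N R by (rule N)
  case 0
  then show ?case using m[of j] N.zero_closed by simp
next
  interpret N: ideal N R by (rule N)
  note ac [simp] = coeff_closed[OF a] and fc [simp] = coeff_closed[OF f]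
  case (Suc d)
  define n where "n = i + j"
  define x where "x = cf a i [^] d"
  have x [simp]: "x \<in> carrier R" by (simp add: x_def)
  define s where "s = (\<Oplus>k\<in>{..n} - {i}. cf a k \<otimes> cf f (n - k))"
  have s [simp]: "s \<in> carrier R" unfolding s_def by (rule R.finsum_closed) auto
  have "{..n} = insert i ({..n} - {i})" by (auto simp: n_def)
  then have "(\<Oplus>k\<in>{..n}. cf a k \<otimes> cf f (n - k))
    = (\<Oplus>k\<in>insert i ({..n} - {i}). cf a k \<otimes> cf f (n - k))" by simp
  also have "\<dots> = cf a i \<otimes> cf f j \<oplus> s"
    unfolding s_def by (subst R.finsum_insert) (auto simp: n_def)
  finally have sum_eq: "(\<Oplus>k\<in>{..n}. cf a k \<otimes> cf f (n - k)) = cf a i \<otimes> cf f j \<oplus> s" .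
  have n0: "n \<noteq> 0" using Suc.prems by (auto simp: n_def)
  have eq: "c \<otimes> [Suc n] \<cdot> cf f (Suc n) \<ominus> (cf a i \<otimes> cf f j \<oplus> s) = \<zero>"
    using preimage_of_one_coeff[OF c a f D, of n] n0 unfolding sum_eq by (simp only: if_False)
  define w where "w = [Suc n] \<cdot> \<one>"
  have w [simp]: "w \<in> carrier R" by (simp add: w_def del: R.add.nat_pow_Suc)
  have wf: "[Suc n] \<cdot> cf f (Suc n) = w \<otimes> cf f (Suc n)"
    using R.add_pow_ldistr[of \<one> "cf f (Suc n)" "Suc n"] by (simp add: w_def del: R.add.nat_pow_Suc)
  \<comment> \<open>This is \<open>eq\<close> times \<open>x\<close>, solved for the term with \<open>a\<^sub>i f\<^sub>j\<close>.\<close>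
  have "x \<otimes> (cf a i \<otimes> cf f j)
      = (c \<otimes> w) \<otimes> (x \<otimes> cf f (Suc n)) \<ominus> x \<otimes> s
        \<ominus> x \<otimes> (c \<otimes> (w \<otimes> cf f (Suc n)) \<ominus> (cf a i \<otimes> cf f j \<oplus> s))"
    using x s w c ac[of i] fc[of j] fc[of "Suc n"] by algebra
  also have "\<dots> = (c \<otimes> w) \<otimes> (x \<otimes> cf f (Suc n)) \<ominus> x \<otimes> s"
    using eq c by (simp add: wf R.minus_eq del: R.add.nat_pow_Suc)
  also have "\<dots> \<in> N"
  proof -
    have "x \<otimes> cf f (Suc n) \<in> N"
      unfolding x_def using Suc.prems by (intro Suc.IH) (auto simp: n_def)
    then have "(c \<otimes> w) \<otimes> (x \<otimes> cf f (Suc n)) \<in> N" using c by (simp add: N.I_l_closed)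
    moreover have "x \<otimes> s \<in> N"
    proof -
      have "x \<otimes> s = (\<Oplus>k\<in>{..n} - {i}. x \<otimes> (cf a k \<otimes> cf f (n - k)))"
        unfolding s_def by (rule R.finsum_rdistr) auto
      also have "\<dots> \<in> N"
      proof (rule R.finsum_in_subgroup[OF N.a_subgroup])
        fix k assume k: "k \<in> {..n} - {i}"
        show "x \<otimes> (cf a k \<otimes> cf f (n - k)) \<in> N"
        proof (cases "i < k")
          case True
          then show ?thesis using top by (intro N.I_l_closed N.I_r_closed) auto
        next
          case False
          then have "x \<otimes> cf f (n - k) \<in> N"
            unfolding x_def using k Suc.prems by (intro Suc.IH) (auto simp: n_def)
          then have "cf a k \<otimes> (x \<otimes> cf f (n - k)) \<in> N" by (simp add: N.I_l_closed)
          then show ?thesis by (simp add: R.m_lcomm)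
        qed
      qed
      finally show ?thesis .
    qed
    ultimately show ?thesis by (simp add: R.minus_eq)
  qed
  finally show ?case by (simp add: x_def R.m_assoc)
qed

lemma preimage_of_one_const:
  assumes "c \<in> carrier R" "a \<in> carrier P" "f \<in> carrier P" "diff_op R c a f = \<one>\<^bsub>P\<^esub>"
  shows "c \<otimes> cf f 1 \<ominus> cf a 0 \<otimes> cf f 0 = \<one>"
  using preimage_of_one_coeff[OF assms, of 0] assms by simp

text \<open>
  The induction runs downwards from the degree of \<open>a\<close>, with the higher coefficients already nilpotent.
  For \<open>i > 0\<close> the descent in \<open>top_coeff_absorbs\<close> reaches \<open>j = 0\<close>, so a power of \<open>a\<^sub>i\<close> multiplies both \<open>f\<^sub>0\<close> and \<open>f\<^sub>1\<close>
  into the nilradical, hence also \<open>1 = c f\<^sub>1 - a\<^sub>0 f\<^sub>0\<close>.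
\<close>

lemma higher_coeff_nilpotent:
  assumes c: "c \<in> carrier R" and a: "a \<in> carrier P" and f: "f \<in> carrier P"
    and D: "diff_op R c a f = \<one>\<^bsub>P\<^esub>" and "0 < i"
  shows "cf a i \<in> R.nilradical"
  using \<open>0 < i\<close>
proof (induction "deg R a - i" arbitrary: i rule: less_induct)
  interpret N: ideal R.nilradical R by (rule R.nilradical_ideal)
  note ac [simp] = coeff_closed[OF a] and fc [simp] = coeff_closed[OF f]
  case less
  have top: "cf a k \<in> R.nilradical" if "i < k" for k
  proof (cases "k \<le> deg R a")
    case True
    then show ?thesis using less that by auto
  next
    case False
    then show ?thesis using deg_aboveD[OF _ a, of k] N.zero_closed by simp
  qed
  define x where "x = cf a i [^] Suc (deg R f)"
  have x [simp]: "x \<in> carrier R" by (simp add: x_def del: R.nat_pow_Suc)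
  have xf: "x \<otimes> cf f j \<in> R.nilradical" for j
    unfolding x_def
    by (rule top_coeff_absorbs[OF c a f D R.nilradical_ideal, where m = "deg R f"])
      (use top less.prems deg_aboveD[OF _ f] in auto)
  have "x = x \<otimes> (c \<otimes> cf f 1 \<ominus> cf a 0 \<otimes> cf f 0)"
    using preimage_of_one_const[OF c a f D] by simp
  also have "\<dots> = c \<otimes> (x \<otimes> cf f 1) \<ominus> cf a 0 \<otimes> (x \<otimes> cf f 0)"
    using c x ac[of 0] fc[of 0] fc[of 1] by algebra
  also have "\<dots> \<in> R.nilradical"
    unfolding R.minus_eq
    by (intro N.a_closed N.a_inv_closed N.I_l_closed[OF xf c] N.I_l_closed[OF xf ac])
  finally show ?case unfolding x_def by (rule R.nilradical_radical[rotated]) simp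
qed

text \<open>
  For \<open>i = 0\<close> the same descent stops at \<open>j = 1\<close>, so only \<open>f\<^sub>1\<close> is absorbed by a power of \<open>a\<^sub>0\<close>; but
  \<open>1 + a\<^sub>0 f\<^sub>0 = c f\<^sub>1\<close>. Modulo nilpotents, \<open>a\<^sub>0\<close> is thus zero or a unit on each of two factors of
  the ring, and this lemma encodes the splitting without naming an idempotent.
\<close>

lemma const_coeff_nilpotent:
  assumes c: "c \<in> carrier R" and a: "a \<in> carrier P" and f: "f \<in> carrier P"
    and D: "diff_op R c a f = \<one>\<^bsub>P\<^esub>"
  shows "cf a 0 \<otimes> (\<one> \<oplus> cf a 0 \<otimes> cf f 0) \<in> R.nilradical"
proof -
  interpret N: ideal R.nilradical R by (rule R.nilradical_ideal)
  note ac [simp] = coeff_closed[OF a] and fc [simp] = coeff_closed[OF f]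
  define m where "m = deg R f"
  define b where "b = cf a 0"
  define e where "e = \<one> \<oplus> b \<otimes> cf f 0"
  have b [simp]: "b \<in> carrier R" and e [simp]: "e \<in> carrier R" by (simp_all add: b_def e_def)
  have bm: "b [^] m \<otimes> cf f 1 \<in> R.nilradical"
    unfolding b_def
    by (intro top_coeff_absorbs[OF c a f D R.nilradical_ideal, of 0 m])
      (auto simp: m_def intro: deg_aboveD f higher_coeff_nilpotent[OF c a f D])
  have "e = \<one> \<oplus> b \<otimes> cf f 0" by (fact e_def)
  also have "\<one> = c \<otimes> cf f 1 \<ominus> b \<otimes> cf f 0"
    using preimage_of_one_const[OF c a f D] by (simp add: b_def)
  also have "c \<otimes> cf f 1 \<ominus> b \<otimes> cf f 0 \<oplus> b \<otimes> cf f 0 = c \<otimes> cf f 1"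
    using c b fc[of 0] fc[of 1] by algebra
  finally have e_eq: "e = c \<otimes> cf f 1" .
  have bme: "b [^] m \<otimes> e \<in> R.nilradical"
    using N.I_l_closed[OF bm c] c by (simp add: e_eq R.m_lcomm)
  have "(b \<otimes> e) [^] Suc m = (b [^] m \<otimes> e) \<otimes> (b \<otimes> e [^] m)"
    by (simp add: R.nat_pow_distrib R.m_ac)
  also have "\<dots> \<in> R.nilradical" by (intro N.I_r_closed[OF bme]) auto
  finally show ?thesis
    using R.nilradical_radical[of "b \<otimes> e" "Suc m"] by (simp add: e_def b_def del: R.nat_pow_Suc)
qed

section \<open>Surjectivity\<close>

lemma mult_in_submodule:
  assumes K: "submodule K R P" and b: "b \<in> carrier P" and g: "g \<in> carrier P"
    and kill: "\<And>i g. g \<in> carrier P \<Longrightarrow> cf b i \<odot>\<^bsub>P\<^esub> g \<in> K"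
  shows "b \<otimes>\<^bsub>P\<^esub> g \<in> K"
proof -
  have cl [simp]: "cf b i \<in> carrier R" for i using b by simp
  have "b = (\<Oplus>\<^bsub>P\<^esub>i\<in>{..deg R b}. up_ring.monom P (cf b i) i)" using up_repr[OF b] by simp
  then have "b \<otimes>\<^bsub>P\<^esub> g = (\<Oplus>\<^bsub>P\<^esub>i\<in>{..deg R b}. up_ring.monom P (cf b i) i) \<otimes>\<^bsub>P\<^esub> g" by simp
  also have "\<dots> = (\<Oplus>\<^bsub>P\<^esub>i\<in>{..deg R b}. up_ring.monom P (cf b i) i \<otimes>\<^bsub>P\<^esub> g)"
    using g by (intro P.finsum_ldistr) auto
  also have "\<dots> \<in> K"
  proof (rule P.finsum_in_subgroup[OF submodule.axioms(1)[OF K]])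
    fix i
    have "up_ring.monom P (cf b i) i = cf b i \<odot>\<^bsub>P\<^esub> up_ring.monom P \<one> i"
      using monom_mult_smult[of "cf b i" \<one> i] by simp
    then show "up_ring.monom P (cf b i) i \<otimes>\<^bsub>P\<^esub> g \<in> K"
      using kill g by (simp add: UP_smult_assoc2)
  qed
  finally show ?thesis .
qed

text \<open>
  Membership in \<open>K\<close> means being zero in the quotient by \<open>K\<close>, on which the nilpotent scalars act as
  zero. For the preimage \<open>f\<close> of \<open>1\<close>, the scalars \<open>u\<close>, \<open>v\<close> are \<open>f\<^sub>1\<close> and \<open>f\<^sub>0\<close>.
\<close>

lemma submodule_eq_carrier_modulo_nilpotents:
  assumes c: "c \<in> carrier R" and a: "a \<in> carrier P"
    and units: "\<And>n. [Suc n] \<cdot> \<one> \<in> Units R"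
    and uv: "u \<in> carrier R" "v \<in> carrier R" "c \<otimes> u \<ominus> cf a 0 \<otimes> v = \<one>"
    and K: "submodule K R P" and D: "diff_op R c a ` carrier P \<subseteq> K"
    and high: "\<And>i g. 0 < i \<Longrightarrow> g \<in> carrier P \<Longrightarrow> cf a i \<odot>\<^bsub>P\<^esub> g \<in> K"
    and const: "\<And>g. g \<in> carrier P \<Longrightarrow> (cf a 0 \<otimes> (\<one> \<oplus> cf a 0 \<otimes> v)) \<odot>\<^bsub>P\<^esub> g \<in> K"
  shows "K = carrier P"
proof -
  note Ksub = submoduleE(1)[OF K] and Kneg = submoduleE(3)[OF K] and Ksm = submoduleE(4)[OF K]
    and Kadd = submoduleE(5)[OF K]
  have Kmin: "s \<ominus>\<^bsub>P\<^esub> t \<in> K" if "s \<in> K" "t \<in> K" for s t using that Kadd Kneg by (simp add: P.minus_eq)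
  have K0: "\<zero>\<^bsub>P\<^esub> \<in> K" using Ksm[of \<zero>] submoduleE(2)[OF K] Ksub by fastforce
  define b where "b = cf a 0"
  have b [simp]: "b \<in> carrier R" using a by (simp add: b_def)
  \<comment> \<open>All coefficients of \<open>h\<close> act as zero modulo \<open>K\<close>, so multiplication by \<open>a\<close> agrees there with
    multiplication by its constant coefficient \<open>b\<close>.\<close>
  define h where "h = a \<ominus>\<^bsub>P\<^esub> up_ring.monom P b 0"
  have h: "h \<in> carrier P" using a by (simp add: h_def)
  have hK: "h \<otimes>\<^bsub>P\<^esub> g \<in> K" if g: "g \<in> carrier P" for g
  proof (rule mult_in_submodule[OF K h g])
    show "cf h i \<odot>\<^bsub>P\<^esub> g \<in> K" if "g \<in> carrier P" for i g
    proof (cases "i = 0")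
      case True
      then have "cf h i = \<zero>" using a by (simp add: h_def b_def P.minus_eq R.r_neg)
      then show ?thesis using that K0 by simp
    next
      case False
      then have "cf h i = cf a i" using a by (simp add: h_def P.minus_eq)
      then show ?thesis using that high False by simp
    qed
  qed
  have cong: "c \<odot>\<^bsub>P\<^esub> UP_deriv R g \<ominus>\<^bsub>P\<^esub> b \<odot>\<^bsub>P\<^esub> g \<in> K" if g: "g \<in> carrier P" for g
  proof -
    define g' where "g' = c \<odot>\<^bsub>P\<^esub> UP_deriv R g"
    have "g' \<in> carrier P" using c g by (simp add: g'_def deriv_closed)
    then have "(g' \<ominus>\<^bsub>P\<^esub> a \<otimes>\<^bsub>P\<^esub> g) \<oplus>\<^bsub>P\<^esub> (a \<ominus>\<^bsub>P\<^esub> up_ring.monom P b 0) \<otimes>\<^bsub>P\<^esub> g = g' \<ominus>\<^bsub>P\<^esub> up_ring.monom P b 0 \<otimes>\<^bsub>P\<^esub> g"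
      using g a monom_closed[OF b, of 0] by algebra
    then have "diff_op R c a g \<oplus>\<^bsub>P\<^esub> h \<otimes>\<^bsub>P\<^esub> g = g' \<ominus>\<^bsub>P\<^esub> b \<odot>\<^bsub>P\<^esub> g"
      using g by (simp add: diff_op_eq g'_def h_def monom_mult_is_smult)
    moreover have "diff_op R c a g \<in> K" using D g by blast
    ultimately show ?thesis using Kadd hK[OF g] by (metis g'_def)
  qed
  have to_b: "b \<odot>\<^bsub>P\<^esub> g \<in> K" if g: "g \<in> carrier P" and k: "c \<odot>\<^bsub>P\<^esub> UP_deriv R g \<in> K" for g
  proof -
    have "b \<odot>\<^bsub>P\<^esub> g = x \<ominus>\<^bsub>P\<^esub> (x \<ominus>\<^bsub>P\<^esub> b \<odot>\<^bsub>P\<^esub> g)" if "x \<in> carrier P" for x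
      using that UP_smult_closed[OF b g] by algebra
    then show ?thesis using Kmin[OF k cong[OF g]] Ksub k by (metis subsetD)
  qed
  have torsion: "b [^] n \<odot>\<^bsub>P\<^esub> g \<in> K" if "g \<in> carrier P" "\<And>j. n \<le> j \<Longrightarrow> cf g j = \<zero>" for n :: nat and g
    using that
  proof (induction n arbitrary: g)
    case 0
    then have "g = \<zero>\<^bsub>P\<^esub>" by (intro up_eqI) auto
    then show ?case using K0 by simp
  next
    case (Suc n)
    have g: "UP_deriv R g \<in> carrier P" using Suc.prems by (simp add: deriv_closed)
    have "b [^] n \<odot>\<^bsub>P\<^esub> UP_deriv R g \<in> K"
      using Suc.prems by (intro Suc.IH) (simp_all add: deriv_closed coeff_UP_deriv del: R.add.nat_pow_Suc)
    then have "c \<odot>\<^bsub>P\<^esub> (b [^] n \<odot>\<^bsub>P\<^esub> UP_deriv R g) \<in> K" using Ksm c by blast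
    then have "c \<odot>\<^bsub>P\<^esub> UP_deriv R (b [^] n \<odot>\<^bsub>P\<^esub> g) \<in> K" using Suc.prems by (simp add: deriv_smult)
    then have "b \<odot>\<^bsub>P\<^esub> (b [^] n \<odot>\<^bsub>P\<^esub> g) \<in> K" using Suc.prems by (intro to_b) auto
    then show ?case using Suc.prems by (simp add: UP_smult_assoc1[symmetric] R.m_comm)
  qed
  \<comment> \<open>By \<open>const\<close>, \<open>b g\<close> and \<open>- v b\<^sup>2 g\<close> agree modulo \<open>K\<close>, so if some power of \<open>b\<close> sends \<open>g\<close> into
    \<open>K\<close>, then so does \<open>b\<close> itself.\<close>
  have down: "b \<odot>\<^bsub>P\<^esub> g \<in> K" if "g \<in> carrier P" "b [^] n \<odot>\<^bsub>P\<^esub> g \<in> K" for n :: nat and g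
    using that
  proof (induction n arbitrary: g)
    case 0
    then show ?case using Ksm b by simp
  next
    case (Suc n)
    have "b [^] n \<odot>\<^bsub>P\<^esub> (b \<odot>\<^bsub>P\<^esub> g) \<in> K"
      using Suc.prems by (simp add: UP_smult_assoc1[symmetric])
    then have "b \<odot>\<^bsub>P\<^esub> (b \<odot>\<^bsub>P\<^esub> g) \<in> K" using Suc.prems by (intro Suc.IH) auto
    then have *: "v \<odot>\<^bsub>P\<^esub> (b \<odot>\<^bsub>P\<^esub> (b \<odot>\<^bsub>P\<^esub> g)) \<in> K" using Ksm uv by blast
    have "b = b \<otimes> (\<one> \<oplus> b \<otimes> v) \<oplus> \<ominus> (v \<otimes> b \<otimes> b)" using b uv(2) by algebra
    then have "b \<odot>\<^bsub>P\<^esub> g = (b \<otimes> (\<one> \<oplus> b \<otimes> v) \<oplus> \<ominus> (v \<otimes> b \<otimes> b)) \<odot>\<^bsub>P\<^esub> g" by simp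
    also have "\<dots> = (b \<otimes> (\<one> \<oplus> b \<otimes> v)) \<odot>\<^bsub>P\<^esub> g \<ominus>\<^bsub>P\<^esub> v \<odot>\<^bsub>P\<^esub> (b \<odot>\<^bsub>P\<^esub> (b \<odot>\<^bsub>P\<^esub> g))"
      using uv(2) Suc.prems by (simp add: UP_smult_l_distr smult_l_minus P.minus_eq UP_smult_assoc1[symmetric] R.m_assoc)
    also have "\<dots> \<in> K" using Kmin * const[OF Suc.prems(1)] by (simp add: b_def)
    finally show ?case .
  qed
  have bK: "b \<odot>\<^bsub>P\<^esub> g \<in> K" if g: "g \<in> carrier P" for g
    using down[OF g torsion[OF g, of "Suc (deg R g)"]] deg_aboveD[OF _ g] by simp
  have cK: "c \<odot>\<^bsub>P\<^esub> g \<in> K" if g: "g \<in> carrier P" for g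
  proof -
    obtain k where k: "k \<in> carrier P" "UP_deriv R k = g" using antiderivative[OF units g] by blast
    have "x = (x \<ominus>\<^bsub>P\<^esub> y) \<oplus>\<^bsub>P\<^esub> y" if "x \<in> carrier P" "y \<in> carrier P" for x y using that by algebra
    then have "c \<odot>\<^bsub>P\<^esub> g = (c \<odot>\<^bsub>P\<^esub> g \<ominus>\<^bsub>P\<^esub> b \<odot>\<^bsub>P\<^esub> k) \<oplus>\<^bsub>P\<^esub> b \<odot>\<^bsub>P\<^esub> k"
      using UP_smult_closed[OF c g] UP_smult_closed[OF b k(1)] by blast
    then show ?thesis using Kadd[OF cong[OF k(1)] bK[OF k(1)]] k by simp
  qed
  have "g \<in> K" if g: "g \<in> carrier P" for g
  proof -
    have "g = (c \<otimes> u \<ominus> b \<otimes> v) \<odot>\<^bsub>P\<^esub> g" using uv g by (simp add: b_def)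
    also have "\<dots> = c \<odot>\<^bsub>P\<^esub> (u \<odot>\<^bsub>P\<^esub> g) \<ominus>\<^bsub>P\<^esub> b \<odot>\<^bsub>P\<^esub> (v \<odot>\<^bsub>P\<^esub> g)"
      using uv(1,2) g c by (simp add: R.minus_eq P.minus_eq UP_smult_l_distr smult_l_minus UP_smult_assoc1)
    also have "\<dots> \<in> K" using Kmin bK cK uv g by simp
    finally show ?thesis .
  qed
  then show ?thesis using Ksub by blast
qed

theorem diff_op_surj:
  assumes units: "\<And>n. [Suc n] \<cdot> \<one> \<in> Units R"
    and c: "c \<in> carrier R" and a: "a \<in> carrier P"
    and one: "\<one>\<^bsub>P\<^esub> \<in> diff_op R c a ` carrier P"
  shows "diff_op R c a ` carrier P = carrier P"
proof -
  obtain f where f: "f \<in> carrier P" and D: "diff_op R c a f = \<one>\<^bsub>P\<^esub>" using one by auto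
  define y where "y = cf a 0 \<otimes> (\<one> \<oplus> cf a 0 \<otimes> cf f 0)"
  define Y where "Y = insert y (cf a ` {0<..deg R a})"
  show ?thesis
  proof (rule nilpotent_Nakayama)
    show "finite Y" by (simp add: Y_def)
    show "Y \<subseteq> R.nilradical"
      using higher_coeff_nilpotent[OF c a f D] const_coeff_nilpotent[OF c a f D]
      by (auto simp: Y_def y_def)
    show "submodule (diff_op R c a ` carrier P) R P" by (rule diff_op_image_submodule[OF c a])
    fix K
    assume K: "submodule K R P" "diff_op R c a ` carrier P \<subseteq> K"
      and Y: "\<And>x m. x \<in> Y \<Longrightarrow> m \<in> carrier P \<Longrightarrow> x \<odot>\<^bsub>P\<^esub> m \<in> K"
    show "K = carrier P"
    proof (rule submodule_eq_carrier_modulo_nilpotents[OF c a units _ _ preimage_of_one_const[OF c a f D] K])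
      show "cf f 1 \<in> carrier R" "cf f 0 \<in> carrier R" using f by auto
      show "cf a i \<odot>\<^bsub>P\<^esub> g \<in> K" if "0 < i" "g \<in> carrier P" for i g
      proof (cases "i \<le> deg R a")
        case True
        then show ?thesis using Y that by (auto simp: Y_def)
      next
        case False
        have "\<zero> \<odot>\<^bsub>P\<^esub> \<one>\<^bsub>P\<^esub> \<in> K" using submoduleE(4)[OF K(1), of \<zero> "\<one>\<^bsub>P\<^esub>"] K one by auto
        then show ?thesis using False deg_aboveD[OF _ a, of i] that by simp
      qed
      show "(cf a 0 \<otimes> (\<one> \<oplus> cf a 0 \<otimes> cf f 0)) \<odot>\<^bsub>P\<^esub> g \<in> K" if "g \<in> carrier P" for g
        using Y that by (auto simp: Y_def y_def)
    qed
  qed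
qed

end

section \<open>Algebras over the rationals\<close>

lemma rat_algebra_nat_Units:
  assumes "algebra rat_ring A"
  shows "[Suc n] \<cdot>\<^bsub>A\<^esub> \<one>\<^bsub>A\<^esub> \<in> Units A"
proof -
  interpret algebra rat_ring A by fact
  have car: "q \<in> carrier rat_ring" for q by (simp add: ring_of_type_algebra_def)
  have add: "(p + q) \<odot>\<^bsub>A\<^esub> \<one>\<^bsub>A\<^esub> = p \<odot>\<^bsub>A\<^esub> \<one>\<^bsub>A\<^esub> \<oplus>\<^bsub>A\<^esub> q \<odot>\<^bsub>A\<^esub> \<one>\<^bsub>A\<^esub>" for p q
    using smult_l_distr[OF car car, of "\<one>\<^bsub>A\<^esub>" p q] by (simp add: ring_of_type_algebra_def)
  have nul: "0 \<odot>\<^bsub>A\<^esub> \<one>\<^bsub>A\<^esub> = \<zero>\<^bsub>A\<^esub>" using smult_l_null[of "\<one>\<^bsub>A\<^esub>"] by (simp add: ring_of_type_algebra_def)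
  have one: "1 \<odot>\<^bsub>A\<^esub> \<one>\<^bsub>A\<^esub> = \<one>\<^bsub>A\<^esub>" using smult_one[of "\<one>\<^bsub>A\<^esub>"] by (simp add: ring_of_type_algebra_def)
  have of_nat: "[k] \<cdot>\<^bsub>A\<^esub> \<one>\<^bsub>A\<^esub> = of_nat k \<odot>\<^bsub>A\<^esub> \<one>\<^bsub>A\<^esub>" for k :: nat
  proof (induction k)
    case 0
    then show ?case by (simp add: nul)
  next
    case (Suc k)
    then show ?case using add[of "of_nat k" 1] by (simp add: one add.commute)
  qed
  define r where "r = (1 / of_nat (Suc n)) \<odot>\<^bsub>A\<^esub> \<one>\<^bsub>A\<^esub>"
  have r: "r \<in> carrier A" unfolding r_def by (intro smult_closed car) simp
  have "([Suc n] \<cdot>\<^bsub>A\<^esub> \<one>\<^bsub>A\<^esub>) \<otimes>\<^bsub>A\<^esub> r = of_nat (Suc n) \<odot>\<^bsub>A\<^esub> (\<one>\<^bsub>A\<^esub> \<otimes>\<^bsub>A\<^esub> r)"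
    unfolding of_nat using r by (intro smult_assoc2 car) auto
  also have "\<dots> = of_nat (Suc n) \<odot>\<^bsub>A\<^esub> r" using r by simp
  also have "\<dots> = (of_nat (Suc n) * (1 / of_nat (Suc n))) \<odot>\<^bsub>A\<^esub> \<one>\<^bsub>A\<^esub>"
    using smult_assoc1[OF car car, of "\<one>\<^bsub>A\<^esub>" "of_nat (Suc n)" "1 / of_nat (Suc n)"]
    by (simp add: r_def ring_of_type_algebra_def)
  also have "\<dots> = \<one>\<^bsub>A\<^esub>" using one by (simp del: of_nat_Suc)
  finally have "([Suc n] \<cdot>\<^bsub>A\<^esub> \<one>\<^bsub>A\<^esub>) \<otimes>\<^bsub>A\<^esub> r = \<one>\<^bsub>A\<^esub>" .
  moreover have "[Suc n] \<cdot>\<^bsub>A\<^esub> \<one>\<^bsub>A\<^esub> \<in> carrier A" by (intro M.add.nat_pow_closed) simp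
  ultimately show ?thesis using r by (auto simp: Units_def m_comm simp del: M.add.nat_pow_Suc)
qed

theorem theorem7p6:
  fixes A :: "(rat, 'a, 'm) module_scheme"
    and a :: "nat \<Rightarrow> 'a" and c :: 'a
  assumes "algebra rat_ring A"
    and "a \<in> carrier (UP A)"
    and "c \<in> carrier A"
    and "\<one>\<^bsub>UP A\<^esub> \<in> diff_op A c a ` carrier (UP A)"
  shows "diff_op A c a ` carrier (UP A) = carrier (UP A)"
proof -
  have "cring A" by (rule algebra.M_cring[OF assms(1)])
  then interpret UP_cring A "UP A" by (simp add: UP_cring_def)
  show ?thesis
    using diff_op_surj[OF rat_algebra_nat_Units[OF assms(1)] assms(3,2,4)] .
qed

end
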